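(* Let $q\geq 1$ and $0\leq r<s$ be fixed integers, let $x$ be a variable (or a complex number), and for $k\ge 0$ set $$b_k := B_k\!\left(\tfrac{x+r}{q}\right)-B_k\!\left(\tfrac{x+s}{q}\right).$$ Then for all integers $m\geq 0$ we have $H_{2m}(b_k)=0$ and $$H_{2m+1}(b_k)=(-1)^{m+1}\left(\frac{s-r}{q^{m+1}}\right)^{2m+2}\prod_{\ell=1}^m\left(\frac{\ell^4\big((s-r)^2-(q\ell)^2\big)}{4(2\ell+1)(2\ell-1)}\right)^{2(m+1-\ell)}.$$
   Context: The Bernoulli polynomials $B_k(x)$ are defined by $\frac{te^{xt}}{e^t-1}=\sum_{k\ge 0}B_k(x)\frac{t^k}{k!}$. For a sequence $(c_0,c_1,c_2,\ldots)$ (indexed from $k=0$), the $n$th Hankel determinant is $H_n(c_k)=\det\big(c_{i+j}\big)_{0\le i,j\le n}$, an $(n+1)\times(n+1)$ determinant. Empty products equal $1$. *)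

theory Defs
  imports
    "HOL-Computational_Algebra.Formal_Power_Series"
    "Jordan_Normal_Form.Determinant"
begin

(* Bernoulli polynomials, read off from t e^{xt} / (e^t - 1) = sum B_k(x) t^k / k!.
   The denominator has no constant term, so this is the division of formal power series
   over a field that cancels the common factor t. *)
definition bernpoly :: "nat \<Rightarrow> 'a::field_char_0 \<Rightarrow> 'a" where
  "bernpoly k x = fact k * fps_nth (fps_X * fps_exp x / (fps_exp 1 - 1)) k"

(* Guards against fps division discarding low-order terms: the quotient above is exact. *)
lemma bernpoly_generating_function:
  fixes x :: "'a::field_char_0"
  shows "Abs_fps (\<lambda>k. bernpoly k x / fact k) * (fps_exp 1 - 1) = fps_X * fps_exp x"
proof -
  let ?g = "fps_exp 1 - 1 :: 'a fps"
  have nth1: "fps_nth ?g 1 \<noteq> 0" by simp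
  then have nz: "?g \<noteq> 0" by (metis fps_zero_nth)
  have "subdegree ?g \<le> 1" using nth1 by (rule subdegree_leI)
  also have "\<dots> \<le> subdegree (fps_X * fps_exp x)"
    by (rule subdegree_geI) (auto simp: fps_eq_iff intro: exI[of _ 1])
  finally have "?g dvd fps_X * fps_exp x"
    using nz by (auto simp: fps_dvd_iff)
  moreover have "Abs_fps (\<lambda>k. bernpoly k x / fact k) = fps_X * fps_exp x / ?g"
    by (simp add: fps_eq_iff bernpoly_def)
  ultimately show ?thesis by simp
qed

(* The n-th Hankel determinant has size n + 1; c is indexed from 0. *)
definition hankel_det :: "nat \<Rightarrow> (nat \<Rightarrow> 'a::comm_ring_1) \<Rightarrow> 'a" where
  "hankel_det n c = Determinant.det (mat (n + 1) (n + 1) (\<lambda>(i, j). c (i + j)))"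

end

theory Submission
  imports Defs
begin

text \<open>
  A Hankel determinant is the Gram determinant of the functional \<open>U\<close> that sends \<open>y^k\<close> to the \<open>k\<close>-th
  moment, taken in any two bases \<open>p\<^sub>i, q\<^sub>i\<close> of degree \<open>i\<close> with reciprocal leading coefficients. A binomial transform recentres the
  moments, after which their exponential generating function is the odd series
  \<open>G = t (e^{ht} - e^{-ht}) / (e^{t/2} - e^{-t/2})\<close> with \<open>2h = (r - s)/q\<close>. Equivalently,
  \<open>U (f(y + 1/2) - f(y - 1/2)) = f'(h) - f'(-h)\<close>. Oddness kills the determinants of odd size.

  For even size take the bases \<open>\<phi>\<^sub>i, y \<phi>\<^sub>i\<close> and \<open>\<psi>\<^sub>j, y \<psi>\<^sub>j\<close>, where
  \<open>\<phi>\<^sub>i = (a + y)\<^sub>i (a - y)\<^sub>i\<close> with \<open>a = 1/2 + h\<close>, and \<open>\<psi>\<^sub>j\<close> is the same with \<open>1/2 - h\<close>; this is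
  the biorthogonality pattern of the Wilson polynomials. The Gram matrix is then a checkerboard whose
  nonzero entries are \<open>U (y \<phi>\<^sub>i \<psi>\<^sub>j) = 2h i! (1 + 2h)\<^sub>i j! (1 - 2h)\<^sub>j / (i + j + 1)\<close>: for \<open>j = 0\<close> the
  polynomial \<open>y \<phi>\<^sub>i\<close> is an explicit central difference, and \<open>\<phi>\<^sub>i\<^sub>+\<^sub>1 \<psi>\<^sub>j - \<phi>\<^sub>i \<psi>\<^sub>j\<^sub>+\<^sub>1\<close> is a constant
  multiple of \<open>\<phi>\<^sub>i \<psi>\<^sub>j\<close>. Up to row and column factors this is the Hilbert matrix.
\<close>

section \<open>Moment functionals and Hankel determinants\<close>

text \<open>The linear functional taking \<open>y^k\<close> to \<open>k!\<close> times the
  \<open>k\<close>-th coefficient of \<open>G\<close>; formally it sends \<open>e^(yt)\<close> to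
  \<open>G(t)\<close>. Indexing it by an exponential generating series turns operations on
  polynomials into operations on series.\<close>

definition umbral :: "'a::field_char_0 fps \<Rightarrow> 'a poly \<Rightarrow> 'a" where
  "umbral G p = (\<Sum>k\<le>degree p. coeff p k * (fact k * fps_nth G k))"

section \<open>Linearity of the functional\<close>

lemma umbral_eq_sum:
  assumes "degree p \<le> n"
  shows "umbral G p = (\<Sum>k\<le>n. coeff p k * (fact k * fps_nth G k))"
  unfolding umbral_def using assms
  by (intro sum.mono_neutral_left) (auto simp: coeff_eq_0)

lemma umbral_add: "umbral G (p + q) = umbral G p + umbral G q"
  using umbral_eq_sum[of p "max (degree p) (degree q)" G] umbral_eq_sum[of q "max (degree p) (degree q)" G]
    umbral_eq_sum[of "p + q" "max (degree p) (degree q)" G] degree_add_le_max[of p q]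
  by (simp add: sum.distrib distrib_right)

lemma umbral_smult: "umbral G (smult c p) = c * umbral G p"
  using umbral_eq_sum[of "smult c p" "degree p" G]
  by (simp add: umbral_def sum_distrib_left mult.assoc)

lemma umbral_minus: "umbral G (- p) = - umbral G p"
  using umbral_smult[of G "-1" p] by simp

lemma umbral_diff: "umbral G (p - q) = umbral G p - umbral G q"
  using umbral_add[of G p "- q"] by (simp add: umbral_minus)

lemma umbral_0 [simp]: "umbral G 0 = 0"
  by (simp add: umbral_def)

lemma umbral_sum: "umbral G (sum f A) = (\<Sum>i\<in>A. umbral G (f i))"
  by (induction A rule: infinite_finite_induct) (simp_all add: umbral_add)

lemma umbral_monom: "umbral G (monom c k) = c * (fact k * fps_nth G k)"
proof -
  have "umbral G (monom c k) = (\<Sum>i\<le>k. coeff (monom c k) i * (fact i * fps_nth G i))"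
    by (rule umbral_eq_sum) (rule degree_monom_le)
  also have "\<dots> = (\<Sum>i\<le>k. if i = k then c * (fact k * fps_nth G k) else 0)"
    by (intro sum.cong) auto
  finally show ?thesis by simp
qed

text \<open>Multiplying the argument by the variable differentiates the series. This recursion
  drives the inductions on polynomials below, mostly with the series left arbitrary.\<close>

lemma umbral_pCons: "umbral G (pCons a p) = a * fps_nth G 0 + umbral (fps_deriv G) p"
proof -
  have "umbral G (pCons a p) = (\<Sum>k\<le>Suc (degree p). coeff (pCons a p) k * (fact k * fps_nth G k))"
    by (rule umbral_eq_sum) (simp add: degree_pCons_le)
  also have "\<dots> = a * fps_nth G 0 + umbral (fps_deriv G) p"
    by (simp add: sum.atMost_Suc_shift umbral_def algebra_simps del: sum.atMost_Suc)
  finally show ?thesis .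
qed

lemma umbral_fps_add: "umbral (G + H) p = umbral G p + umbral H p"
  by (simp add: umbral_def sum.distrib algebra_simps)

lemma umbral_fps_diff: "umbral (G - H) p = umbral G p - umbral H p"
  by (simp add: umbral_def sum_subtractf algebra_simps)

lemma umbral_fps_minus: "umbral (- G) p = - umbral G p"
  by (simp add: umbral_def sum_negf)

lemma umbral_fps_const_mult: "umbral (fps_const c * G) p = c * umbral G p"
  by (simp add: umbral_def sum_distrib_left mult_ac)

text \<open>Dual form of \<open>e^((y+c)t) = e^(ct) e^(yt)\<close>.\<close>

lemma umbral_shift: "umbral G (p \<circ>\<^sub>p [:c, 1:]) = umbral (fps_exp c * G) p"
proof (induction p arbitrary: G)
  case 0
  then show ?case by simp
next
  case (pCons a p)
  have "pCons a p \<circ>\<^sub>p [:c, 1:] = [:a:] + smult c (p \<circ>\<^sub>p [:c, 1:]) + pCons 0 (p \<circ>\<^sub>p [:c, 1:])"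
    by (simp add: pcompose_pCons)
  moreover have "fps_deriv (fps_exp c * G) = fps_const c * (fps_exp c * G) + fps_exp c * fps_deriv G"
    by (simp add: algebra_simps)
  ultimately show ?case
    by (simp add: umbral_add umbral_smult umbral_pCons umbral_fps_add umbral_fps_const_mult
        pCons.IH del: fps_deriv_mult add_pCons)
qed

text \<open>Dual form of \<open>d/dy e^(yt) = t e^(yt)\<close>.\<close>

lemma umbral_pderiv: "umbral G (pderiv p) = umbral (fps_X * G) p"
  by (induction p arbitrary: G)
    (simp_all add: pderiv_pCons umbral_add umbral_pCons umbral_fps_add)

lemma umbral_fps_exp: "umbral (fps_exp c) p = poly p c"
  by (induction p) (simp_all add: umbral_pCons umbral_fps_const_mult)

lemma umbral_reflect: "umbral G (p \<circ>\<^sub>p [:0, -1:]) = umbral (G oo (fps_const (-1) * fps_X)) p"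
proof (induction p arbitrary: G)
  case 0
  then show ?case by simp
next
  case (pCons a p)
  have "pCons a p \<circ>\<^sub>p [:0, -1:] = pCons a (- (p \<circ>\<^sub>p [:0, -1:]))"
    by (simp add: pcompose_pCons)
  moreover have "fps_deriv (G oo (fps_const (-1) * fps_X)) = - (fps_deriv G oo (fps_const (-1) * fps_X))"
    unfolding fps_compose_linear by (simp add: fps_eq_iff algebra_simps)
  moreover have "fps_nth (G oo (fps_const (-1) * fps_X)) 0 = fps_nth G 0"
    by (simp add: fps_compose_linear)
  ultimately show ?case
    by (simp only: umbral_pCons umbral_minus umbral_fps_minus pCons.IH)
qed

section \<open>Hankel determinants as Gram determinants\<close>

lemma umbral_mult:
  assumes "degree p \<le> m" "degree q \<le> n"
  shows "umbral G (p * q) = (\<Sum>i\<le>m. \<Sum>j\<le>n. coeff p i * coeff q j * (fact (i + j) * fps_nth G (i + j)))"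
proof -
  have "p * q = (\<Sum>i\<le>m. monom (coeff p i) i) * (\<Sum>j\<le>n. monom (coeff q j) j)"
    using assms by (simp add: poly_as_sum_of_monoms')
  also have "\<dots> = (\<Sum>i\<le>m. \<Sum>j\<le>n. monom (coeff p i * coeff q j) (i + j))"
    by (simp add: sum_product mult_monom)
  finally show ?thesis
    by (simp add: umbral_sum umbral_monom)
qed

text \<open>The Gram matrix factors as \<open>P * (H * Q)\<close> with coefficient matrices
  \<open>P\<close> and \<open>Q\<close>. The degree bounds make these triangular, so only the
  diagonal coefficients enter.\<close>

lemma det_gram:
  assumes p: "\<And>i. i \<le> n \<Longrightarrow> degree (p i) \<le> i" and q: "\<And>i. i \<le> n \<Longrightarrow> degree (q i) \<le> i"
  shows "det (mat (n + 1) (n + 1) (\<lambda>(i, j). umbral G (p i * q j))) =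
    (\<Prod>i\<le>n. coeff (p i) i * coeff (q i) i) * hankel_det n (\<lambda>k. fact k * fps_nth G k)"
proof -
  define P where "P = mat (n + 1) (n + 1) (\<lambda>(i, j). coeff (p i) j)"
  define Q where "Q = mat (n + 1) (n + 1) (\<lambda>(i, j). coeff (q j) i)"
  define H where "H = mat (n + 1) (n + 1) (\<lambda>(i, j). fact (i + j) * fps_nth G (i + j))"
  have carr: "P \<in> carrier_mat (n + 1) (n + 1)" "Q \<in> carrier_mat (n + 1) (n + 1)"
    "H \<in> carrier_mat (n + 1) (n + 1)"
    by (simp_all add: P_def Q_def H_def)
  have zero_p: "coeff (p i) j = 0" if "i < j" "j < Suc n" for i j
    using p[of i] that by (intro coeff_eq_0) auto
  have zero_q: "coeff (q i) j = 0" if "i < j" "i < Suc n" for i j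
    using q[of i] that by (intro coeff_eq_0) auto
  have set_eq: "{0..<Suc n} = {..n}" by auto
  have "mat (n + 1) (n + 1) (\<lambda>(i, j). umbral G (p i * q j)) = P * (H * Q)"
  proof (rule eq_matI)
    fix i j assume ij: "i < dim_row (P * (H * Q))" "j < dim_col (P * (H * Q))"
    then have "i \<le> n" "j \<le> n" by (auto simp: P_def Q_def)
    then have "umbral G (p i * q j) = 
        (\<Sum>k\<le>n. \<Sum>l\<le>n. coeff (p i) k * coeff (q j) l * (fact (k + l) * fps_nth G (k + l)))"
      using p q by (intro umbral_mult) (meson order_trans)+
    moreover have "(P * (H * Q)) $$ (i, j) = 
        (\<Sum>k\<le>n. \<Sum>l\<le>n. coeff (p i) k * coeff (q j) l * (fact (k + l) * fps_nth G (k + l)))"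
      using \<open>i \<le> n\<close> \<open>j \<le> n\<close>
      by (simp add: P_def Q_def H_def scalar_prod_def set_eq sum_distrib_left mult_ac del: sum.atMost_Suc)
    ultimately show "mat (n + 1) (n + 1) (\<lambda>(i, j). umbral G (p i * q j)) $$ (i, j) = (P * (H * Q)) $$ (i, j)"
      using \<open>i \<le> n\<close> \<open>j \<le> n\<close> by simp
  qed (simp_all add: P_def Q_def)
  moreover have "det P = (\<Prod>i\<le>n. coeff (p i) i)"
    using zero_p by (subst det_lower_triangular[OF _ carr(1)])
      (simp_all add: P_def prod_list_diag_prod set_eq del: prod.atMost_Suc)
  moreover have "det Q = (\<Prod>i\<le>n. coeff (q i) i)"
    using zero_q by (subst det_upper_triangular[OF _ carr(2)])
      (auto simp: Q_def prod_list_diag_prod set_eq simp del: prod.atMost_Suc)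
  moreover have "det H = hankel_det n (\<lambda>k. fact k * fps_nth G k)"
    by (simp add: H_def hankel_det_def)
  ultimately show ?thesis
    by (simp add: det_mult[OF carr(1) mult_carrier_mat[OF carr(3) carr(2)]] det_mult[OF carr(3,2)]
        prod.distrib mult_ac)
qed

text \<open>The powers of \<open>y + c\<close> are monic, so their Gram determinant under
  \<open>G\<close> is the Hankel determinant of \<open>G\<close>; by translation it is also that of
  the powers of \<open>y\<close> under \<open>fps_exp c * G\<close>.\<close>

lemma hankel_det_binomial_transform:
  fixes G :: "'a::field_char_0 fps"
  shows
  "hankel_det n (\<lambda>k. fact k * fps_nth (fps_exp c * G) k) = hankel_det n (\<lambda>k. fact k * fps_nth G k)"
proof -
  let ?p = "\<lambda>i. [:c, 1:] ^ i" and ?m = "\<lambda>i. [:0, 1:] ^ i"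
  have eq: "umbral G (?p i * ?p j) = umbral (fps_exp c * G) (?m i * ?m j)" for i j
  proof -
    have "(?m i * ?m j) \<circ>\<^sub>p [:c, 1:] = ?p i * ?p j"
      by (rule poly_ext) (simp add: poly_pcompose)
    then show ?thesis by (metis umbral_shift)
  qed
  have lc: "coeff ([:a, 1:] ^ i) i = 1" for a :: 'a and i
    by (metis coeff_linear_power)
  have deg: "degree ([:a, 1:] ^ i) \<le> i" for a :: 'a and i
    by (simp add: degree_linear_power)
  show ?thesis
    using det_gram[of n ?p ?p G] det_gram[of n ?m ?m "fps_exp c * G"] by (simp add: eq lc deg)
qed

text \<open>Passing to the basis \<open>(-1)^i y^i\<close> keeps the determinant, but by oddness it
  negates every entry. As the size \<open>2 * m + 1\<close> is odd, the determinant equals its own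
  negative.\<close>

lemma hankel_det_even_eq_0:
  fixes G :: "'a::field_char_0 fps"
  assumes odd: "G oo (fps_const (-1) * fps_X) = - G"
  shows "hankel_det (2 * m) (\<lambda>k. fact k * fps_nth G k) = 0"
proof -
  let ?H = "mat (2 * m + 1) (2 * m + 1) (\<lambda>(i, j). fact (i + j) * fps_nth G (i + j))"
  have *: "(-1) ^ k * fps_nth G k = - fps_nth G k" for k
    using arg_cong[OF odd, of "\<lambda>f. fps_nth f k"] by (simp add: fps_compose_linear)
  have "det (mat (2 * m + 1) (2 * m + 1) (\<lambda>(i, j). umbral G (monom ((-1) ^ i) i * monom ((-1) ^ j) j))) =
      (\<Prod>i\<le>2 * m. coeff (monom ((-1) ^ i) i) i * coeff (monom ((-1) ^ i) i) i) *
      hankel_det (2 * m) (\<lambda>k. fact k * fps_nth G k)"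
    by (rule det_gram) (simp_all add: degree_monom_le)
  also have "(\<Prod>i\<le>2 * m. coeff (monom ((-1) ^ i) i) i * coeff (monom ((-1) ^ i) i) i) = (1 :: 'a)"
    by (intro prod.neutral) (simp flip: power_add)
  also have "mat (2 * m + 1) (2 * m + 1) (\<lambda>(i, j). umbral G (monom ((-1) ^ i) i * monom ((-1) ^ j) j)) = (-1) \<cdot>\<^sub>m ?H"
    using * by (intro eq_matI) (auto simp: mult_monom umbral_monom mult.left_commute[of _ "fact _"] simp flip: power_add)
  also have "det \<dots> = - hankel_det (2 * m) (\<lambda>k. fact k * fps_nth G k)"
    unfolding det_smult by (simp add: hankel_det_def)
  finally show ?thesis by simp
qed

section \<open>Cauchy, Hilbert and checkerboard determinants\<close>

text \<open>
  The product on the right, divided by \<open>x i + y j\<close>, is what remains of the Cauchy matrix after \<open>n\<close> steps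
  of Gaussian elimination; it vanishes once \<open>n\<close> exceeds \<open>i\<close> or \<open>j\<close>, which gives the LU decomposition.
\<close>
lemma cauchy_residual_telescope:
  fixes x y :: "nat \<Rightarrow> 'a::field"
  assumes nz: "\<And>i j. x i + y j \<noteq> 0"
  shows "(\<Sum>k<n. (x k + y k) *
      ((\<Prod>t<k. x i - x t) / (\<Prod>t\<le>k. x i + y t)) * ((\<Prod>t<k. y j - y t) / (\<Prod>t\<le>k. x t + y j))) =
    (1 - (\<Prod>t<n. (x i - x t) * (y j - y t) / ((x i + y t) * (x t + y j)))) / (x i + y j)"
proof (induction n)
  case (Suc n)
  define R where "R = (\<Prod>t<n. (x i - x t) * (y j - y t) / ((x i + y t) * (x t + y j)))"
  define f where "f = (x i - x n) * (y j - y n) / ((x i + y n) * (x n + y j))"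
  have R: "((\<Prod>t<n. x i - x t) / (\<Prod>t\<le>n. x i + y t)) * ((\<Prod>t<n. y j - y t) / (\<Prod>t\<le>n. x t + y j))
      = R / ((x i + y n) * (x n + y j))"
    by (simp add: R_def prod_dividef prod.distrib lessThan_Suc_atMost[symmetric])
  \<comment> \<open>This is \<open>(x i + y n)(x n + y j) - (x i - x n)(y j - y n) = (x i + y j)(x n
    + y n)\<close> after division.\<close>
  have "(x n + y n) / ((x i + y n) * (x n + y j)) = (1 - f) / (x i + y j)"
    using nz[of i n] nz[of n j] nz[of i j] by (simp add: f_def divide_simps) (simp add: algebra_simps)
  then have "(x n + y n) * (R / ((x i + y n) * (x n + y j))) = R * ((1 - f) / (x i + y j))"
    by (metis mult.commute times_divide_eq_right)
  moreover have "(1 - R) / (x i + y j) + R * ((1 - f) / (x i + y j)) = (1 - R * f) / (x i + y j)"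
    by (simp add: algebra_simps flip: add_divide_distrib)
  ultimately show ?case
    using R by (simp only: sum.lessThan_Suc prod.lessThan_Suc Suc.IH[unfolded mult.assoc] mult.assoc f_def[symmetric] R_def[symmetric])
qed simp

lemma det_cauchy:
  fixes x y :: "nat \<Rightarrow> 'a::field"
  assumes nz: "\<And>i j. x i + y j \<noteq> 0"
  shows "det (mat n n (\<lambda>(i, j). 1 / (x i + y j))) =
    (\<Prod>k<n. (x k + y k) *
      ((\<Prod>t<k. x k - x t) / (\<Prod>t\<le>k. x k + y t)) * ((\<Prod>t<k. y k - y t) / (\<Prod>t\<le>k. x t + y k)))"
proof -
  define L where "L = mat n n (\<lambda>(i, k). (x k + y k) * ((\<Prod>t<k. x i - x t) / (\<Prod>t\<le>k. x i + y t)))"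
  define U where "U = mat n n (\<lambda>(k, j). (\<Prod>t<k. y j - y t) / (\<Prod>t\<le>k. x t + y j))"
  have carr: "L \<in> carrier_mat n n" "U \<in> carrier_mat n n"
    by (simp_all add: L_def U_def)
  have "mat n n (\<lambda>(i, j). 1 / (x i + y j)) = L * U"
  proof (rule eq_matI)
    fix i j assume "i < dim_row (L * U)" "j < dim_col (L * U)"
    then have ij: "i < n" "j < n" by (auto simp: L_def U_def)
    \<comment> \<open>The factor at \<open>t = i\<close> is zero, so after \<open>n\<close> steps
      nothing is left of the residual.\<close>
    have prod: "(\<Prod>t<n. (x i - x t) * (y j - y t) / ((x i + y t) * (x t + y j))) = 0"
      using ij by (intro prod_zero) auto
    show "mat n n (\<lambda>(i, j). 1 / (x i + y j)) $$ (i, j) = (L * U) $$ (i, j)"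
      using ij cauchy_residual_telescope[of x y i j n, OF nz]
      unfolding prod by (simp add: L_def U_def scalar_prod_def atLeast0LessThan)
  qed (simp_all add: L_def U_def)
  moreover have "det L = (\<Prod>k<n. (x k + y k) * ((\<Prod>t<k. x k - x t) / (\<Prod>t\<le>k. x k + y t)))"
    by (subst det_lower_triangular[OF _ carr(1)])
      (auto simp: L_def prod_list_diag_prod atLeast0LessThan intro!: prod_zero)
  moreover have "det U = (\<Prod>k<n. (\<Prod>t<k. y k - y t) / (\<Prod>t\<le>k. x t + y k))"
    by (subst det_upper_triangular[OF _ carr(2)])
      (auto simp: U_def upper_triangular_def prod_list_diag_prod atLeast0LessThan intro!: prod_zero)
  ultimately show ?thesis
    by (simp only: det_mult[OF carr] prod.distrib[symmetric])
qed

text \<open>Sorting the even indices before the odd ones leaves two copies of one block off the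
  diagonal and zeros on it.\<close>

lemma det_checkerboard:
  fixes E :: "nat \<Rightarrow> nat \<Rightarrow> 'a::idom"
  shows "det (mat (2 * n) (2 * n) (\<lambda>(i, j). if even (i + j) then 0 else E (i div 2) (j div 2))) =
    (-1) ^ n * det (mat n n (\<lambda>(i, j). E i j)) ^ 2"
proof -
  define A where "A = mat (2 * n) (2 * n) (\<lambda>(i, j). if even (i + j) then 0 else E (i div 2) (j div 2))"
  define B where "B = mat n n (\<lambda>(i, j). E i j)"
  \<comment> \<open>The same reordering of rows and columns, even indices first, so its sign does not matter.\<close>
  define \<pi> where "\<pi> i = (if i < n then 2 * i else if i < 2 * n then 2 * (i - n) + 1 else i)" for i :: nat
  have A: "A \<in> carrier_mat (2 * n) (2 * n)" and B: "B \<in> carrier_mat n n"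
    by (simp_all add: A_def B_def)
  have perm: "\<pi> permutes {0..<2 * n}"
  proof (rule bij_imp_permutes)
    have "inj_on \<pi> {0..<2 * n}"
      by (auto simp: inj_on_def \<pi>_def split: if_splits) presburger+
    moreover have "\<pi> ` {0..<2 * n} \<subseteq> {0..<2 * n}"
      by (auto simp: \<pi>_def)
    ultimately show "bij_betw \<pi> {0..<2 * n} {0..<2 * n}"
      by (simp add: bij_betw_def endo_inj_surj)
  qed (auto simp: \<pi>_def)
  define A1 where "A1 = mat (2 * n) (2 * n) (\<lambda>(i, j). A $$ (\<pi> i, j))"
  have A1: "A1\<^sup>T \<in> carrier_mat (2 * n) (2 * n)" "A1 \<in> carrier_mat (2 * n) (2 * n)"
    by (simp_all add: A1_def)
  \<comment> \<open>Columns are permuted as rows of the transpose, which is not undone: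
    \<open>A2\<close> has entry \<open>A $$ (\<pi> j, \<pi> i)\<close> at \<open>(i, j)\<close>,
    hence the blocks \<open>B\<^sup>T\<close>.\<close>
  define A2 where "A2 = mat (2 * n) (2 * n) (\<lambda>(i, j). A1\<^sup>T $$ (\<pi> i, j))"
  have "det A2 = signof \<pi> * (signof \<pi> * det A)"
    unfolding A2_def det_permute_rows[OF A1(1) perm] det_transpose[OF A1(2)]
    by (simp add: A1_def det_permute_rows[OF A perm])
  also have "\<dots> = det A"
    by (simp add: sign_def)
  finally have "det A = det A2" by simp
  also have "A2 = four_block_mat (0\<^sub>m n n) B\<^sup>T B\<^sup>T (0\<^sub>m n n)"
    by (rule eq_matI) (auto simp: A2_def A1_def A_def B_def \<pi>_def)
  also have "det \<dots> = det (0\<^sub>m n n * 0\<^sub>m n n - B\<^sup>T * B\<^sup>T)"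
    using B by (intro det_four_block_mat) auto
  also have "0\<^sub>m n n * 0\<^sub>m n n - B\<^sup>T * B\<^sup>T = (-1) \<cdot>\<^sub>m (B\<^sup>T * B\<^sup>T)"
    using B by (intro eq_matI) auto
  also have "det \<dots> = (-1) ^ n * det B ^ 2"
    using B by (simp add: det_mult[where n = n] det_transpose power2_eq_square)
  finally show ?thesis by (simp add: A_def B_def)
qed

lemma det_scale_rows_cols:
  fixes c d :: "nat \<Rightarrow> 'a::comm_ring_1"
  shows "det (mat n n (\<lambda>(i, j). c i * d j * A i j)) = (\<Prod>i<n. c i * d i) * det (mat n n (\<lambda>(i, j). A i j))"
proof -
  have "signof p * (\<Prod>i = 0..<n. mat n n (\<lambda>(i, j). c i * d j * A i j) $$ (i, p i)) =
      (\<Prod>i<n. c i * d i) * (signof p * (\<Prod>i = 0..<n. mat n n (\<lambda>(i, j). A i j) $$ (i, p i)))"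
    if p: "p permutes {0..<n}" for p
  proof -
    have "(\<Prod>i = 0..<n. mat n n (\<lambda>(i, j). c i * d j * A i j) $$ (i, p i)) = (\<Prod>i = 0..<n. c i * d (p i) * A i (p i))"
      using permutes_in_image[OF p] by (intro prod.cong) auto
    moreover have "(\<Prod>i = 0..<n. mat n n (\<lambda>(i, j). A i j) $$ (i, p i)) = (\<Prod>i = 0..<n. A i (p i))"
      using permutes_in_image[OF p] by (intro prod.cong) auto
    moreover have "(\<Prod>i = 0..<n. d (p i)) = (\<Prod>i = 0..<n. d i)"
      using prod.permute[OF p, of d] by (simp add: o_def)
    ultimately show ?thesis
      by (simp add: prod.distrib mult_ac flip: atLeast0LessThan)
  qed
  then show ?thesis
    by (simp add: det_def'[where n = n] sum_distrib_left)
qed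

text \<open>The Cauchy determinant at \<open>x i = i\<close>, \<open>y j = j + 1\<close>. One factor
  per elimination step is kept, to be paired later with the \<open>k\<close>-th row and column
  factors of the Gram matrix.\<close>

lemma det_hilbert:
  "det (mat n n (\<lambda>(i, j). 1 / of_nat (i + j + 1) :: 'a::field_char_0)) =
    (\<Prod>k<n. of_nat (2 * k + 1) * (fact k ^ 2 / fact (2 * k + 1)) ^ 2)"
proof -
  have num: "(\<Prod>t<k. of_nat k - of_nat t) = (fact k :: 'a)" for k
    by (simp add: fact_prod_rev of_nat_diff atLeast0LessThan)
  have den: "(\<Prod>t\<le>k. of_nat k + (of_nat t + 1)) = (fact (2 * k + 1) / fact k :: 'a)" for k
  proof -
    have "fact (2 * k + 1) = (fact k :: 'a) * pochhammer (1 + of_nat k) (k + 1)"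
      using pochhammer_product[of k "2 * k + 1" "1 :: 'a"] by (simp add: pochhammer_fact)
    moreover have "pochhammer (1 + of_nat k) (k + 1) = (\<Prod>t\<le>k. of_nat k + (of_nat t + 1) :: 'a)"
      by (simp add: pochhammer_prod lessThan_Suc_atMost atLeast0LessThan add_ac del: prod.lessThan_Suc)
    ultimately show ?thesis by simp
  qed
  have "(of_nat i + (of_nat j + 1) :: 'a) \<noteq> 0" for i j
  proof -
    have "(of_nat (i + j + 1) :: 'a) \<noteq> 0" by (simp only: of_nat_eq_0_iff)
    then show ?thesis by (simp add: add_ac)
  qed
  note cauchy = det_cauchy[of "of_nat :: nat \<Rightarrow> 'a" "\<lambda>j. of_nat j + 1", OF this, of n]
  have "mat n n (\<lambda>(i, j). 1 / of_nat (i + j + 1) :: 'a) = mat n n (\<lambda>(i, j). 1 / (of_nat i + (of_nat j + 1)))"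
    by (intro eq_matI) (auto simp: add_ac)
  moreover have "(\<Prod>t\<le>k. of_nat t + (of_nat k + 1)) = (fact (2 * k + 1) / fact k :: 'a)" for k
    using den[of k] by (simp only: add_ac)
  moreover have "(\<Prod>t<k. of_nat k + 1 - (of_nat t + 1)) = (fact k :: 'a)" for k
    using num[of k] by (simp only: add_diff_cancel_right)
  moreover have "fact k / (fact (2 * k + 1) / fact k) = (fact k ^ 2 / fact (2 * k + 1) :: 'a)" for k
    by (simp only: divide_divide_eq_right power2_eq_square)
  moreover have "of_nat k + (of_nat k + 1) = (of_nat (2 * k + 1) :: 'a)" for k
    by simp
  ultimately show ?thesis
    by (simp only: cauchy num den power2_eq_square mult.assoc)
qed

section \<open>The Wilson basis\<close>

text \<open>The product \<open>(a + y)_n (a - y)_n\<close> of rising factorials, with its factors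
  paired as \<open>(a + k)^2 - y^2\<close> so that it is visibly even in \<open>y\<close>.\<close>

definition wilson_basis :: "'a::field_char_0 \<Rightarrow> nat \<Rightarrow> 'a poly" where
  "wilson_basis a n = (\<Prod>k<n. [:(a + of_nat k)^2, 0, -1:])"

lemma wilson_basis_0 [simp]: "wilson_basis a 0 = 1"
  by (simp add: wilson_basis_def)

lemma wilson_basis_Suc: "wilson_basis a (Suc n) = wilson_basis a n * [:(a + of_nat n)^2, 0, -1:]"
  by (simp add: wilson_basis_def)

lemma poly_wilson_basis_Suc:
  "poly (wilson_basis a (Suc n)) y = poly (wilson_basis a n) y * ((a + of_nat n)^2 - y^2)"
  by (simp add: wilson_basis_Suc power2_eq_square algebra_simps)

lemma wilson_basis_reflect: "wilson_basis a n \<circ>\<^sub>p [:0, -1:] = wilson_basis a n"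
proof (induction n)
  case (Suc n)
  have "[:(a + of_nat n)^2, 0, -1:] \<circ>\<^sub>p [:0, -1:] = [:(a + of_nat n)^2, 0, -1:]"
    by (simp add: pcompose_pCons)
  with Suc show ?case by (simp only: wilson_basis_Suc pcompose_mult)
qed (simp add: pcompose_1)

lemma degree_wilson_basis: "degree (wilson_basis a n) \<le> 2 * n"
proof (induction n)
  case (Suc n)
  have "degree (wilson_basis a n * [:(a + of_nat n)^2, 0, -1:]) \<le> 
      degree (wilson_basis a n) + degree [:(a + of_nat n)^2, 0, -1:]"
    by (rule degree_mult_le)
  with Suc show ?case by (simp add: wilson_basis_Suc)
qed simp

lemma coeff_wilson_basis: "coeff (wilson_basis a n) (2 * n) = (-1) ^ n"
proof (induction n)
  case (Suc n)
  have "coeff (wilson_basis a n * [:(a + of_nat n)^2, 0, -1:]) (2 * n + 2) = - ((-1) ^ n)"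
    using degree_wilson_basis[of a n] Suc
    by (simp add: coeff_eq_0 algebra_simps coeff_pCons numeral_2_eq_2)
  then show ?case by (simp add: wilson_basis_Suc)
qed simp

text \<open>Shifting by \<open>1/2\<close> gives
  \<open>(h + 1/2 + y)_(n+1) (h - 1/2 - y)_(n+1)\<close>, which contains
  \<open>wilson_basis (h + 1/2) n\<close> and two linear factors. The shift by \<open>-1/2\<close>
  has the same common part, and the difference of the leftover quadratics is linear in
  \<open>y\<close>.\<close>

lemma wilson_basis_shift_diff:
  "wilson_basis h (Suc n) \<circ>\<^sub>p [:1/2, 1:] - wilson_basis h (Suc n) \<circ>\<^sub>p [:-1/2, 1:] =
    smult (- 2 * of_nat (Suc n)) ([:0, 1:] * wilson_basis (h + 1/2) n)"
proof -
  have plus: "poly (wilson_basis h (Suc n)) (1/2 + y) =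
      poly (wilson_basis (h + 1/2) n) y * (h + of_nat n + 1/2 + y) * (h - 1/2 - y)" for y
  proof (induction n)
    case 0
    show ?case by (simp add: wilson_basis_Suc power2_eq_square algebra_simps)
  next
    case (Suc n)
    have "poly (wilson_basis h (Suc (Suc n))) (1/2 + y) = 
        (poly (wilson_basis (h + 1/2) n) y * (h + of_nat n + 1/2 + y) * (h - 1/2 - y)) *
        ((h + of_nat (Suc n))^2 - (1/2 + y)^2)"
      unfolding poly_wilson_basis_Suc[of h "Suc n"] Suc.IH ..
    also have "\<dots> = poly (wilson_basis (h + 1/2) n) y * (((h + 1/2 + of_nat n)^2 - y^2) *
        (h + of_nat (Suc n) + 1/2 + y)) * (h - 1/2 - y)"
    proof -
      have "(h + of_nat n + 1/2 + y) * ((h + of_nat (Suc n))^2 - (1/2 + y)^2) =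
          ((h + 1/2 + of_nat n)^2 - y^2) * (h + of_nat (Suc n) + 1/2 + y)"
      proof -
        define u where "u = h + of_nat n + 1/2"
        have "(h + of_nat (Suc n))^2 - (1/2 + y)^2 = (u - y) * (u + 1 + y)"
          by (simp add: u_def power2_eq_square field_simps)
        moreover have "(h + 1/2 + of_nat n)^2 - y^2 = (u + y) * (u - y)"
          by (simp add: u_def power2_eq_square algebra_simps)
        moreover have "h + of_nat (Suc n) + 1/2 + y = u + 1 + y"
          by (simp add: u_def)
        ultimately show ?thesis by (simp add: u_def [symmetric] mult_ac)
      qed
      then show ?thesis by (simp add: mult_ac)
    qed
    finally show ?case
      by (simp only: poly_wilson_basis_Suc[of "h + 1/2"] mult.assoc)
  qed
  have even: "poly (wilson_basis a k) (- y) = poly (wilson_basis a k) y" for a y :: 'a and k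
    using arg_cong[OF wilson_basis_reflect[of a k], of "\<lambda>p. poly p y"] by (simp add: poly_pcompose)
  \<comment> \<open>By evenness the value at \<open>y - 1/2\<close> is the value at
    \<open>1/2 - y\<close>, which is \<open>plus\<close> at \<open>- y\<close>.\<close>
  have minus: "poly (wilson_basis h (Suc n)) (y - 1/2) =
      poly (wilson_basis (h + 1/2) n) y * (h + of_nat n + 1/2 - y) * (h - 1/2 + y)" for y
    using plus[of "- y"] even[of h "Suc n" "1/2 - y"] even[of "h + 1/2" n y] by simp
  show ?thesis
  proof (rule poly_ext)
    fix y
    define P where "P = poly (wilson_basis (h + 1/2) n) y"
    define u where "u = h + of_nat n + 1/2"
    have "poly (wilson_basis h (Suc n) \<circ>\<^sub>p [:1/2, 1:] - wilson_basis h (Suc n) \<circ>\<^sub>p [:-1/2, 1:]) y =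
        P * (u + y) * (h - 1/2 - y) - P * (u - y) * (h - 1/2 + y)"
      using plus[of y] minus[of y] by (simp add: poly_pcompose P_def u_def)
    also have "\<dots> = P * (2 * y * (h - 1/2 - u))"
      by (simp add: algebra_simps)
    also have "h - 1/2 - u = - of_nat (Suc n)"
      by (simp add: u_def field_simps)
    finally show "poly (wilson_basis h (Suc n) \<circ>\<^sub>p [:1/2, 1:] - wilson_basis h (Suc n) \<circ>\<^sub>p [:-1/2, 1:]) y =
        poly (smult (- 2 * of_nat (Suc n)) ([:0, 1:] * wilson_basis (h + 1/2) n)) y"
      by (simp add: P_def)
  qed
qed

text \<open>The factor for \<open>k = 0\<close> vanishes at \<open>x\<close>, so the product rule
  leaves only its derivative \<open>- 2 * x\<close> times the values
  \<open>(h + k)^2 - h^2 = k (2h + k)\<close>. The hypothesis treats \<open>x = h\<close> and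
  \<open>x = - h\<close> together.\<close>

lemma poly_pderiv_wilson_basis:
  assumes "x^2 = h^2"
  shows "poly (pderiv (wilson_basis h (Suc n))) x = - 2 * x * (fact n * pochhammer (2 * h + 1) n)"
proof (induction n)
  case 0
  show ?case by (simp add: wilson_basis_Suc pderiv_pCons)
next
  case (Suc n)
  have zero: "poly (wilson_basis h (Suc n)) x = 0"
    using assms by (auto simp: wilson_basis_def poly_prod power2_eq_square intro!: bexI[of _ 0] simp del: prod.lessThan_Suc)
  have "(h + of_nat (Suc n))^2 - x^2 = of_nat (Suc n) * (2 * h + 1 + of_nat n)"
    unfolding assms by (simp add: power2_eq_square algebra_simps)
  then have "poly [:(h + of_nat (Suc n))^2, 0, -1:] x = of_nat (Suc n) * (2 * h + 1 + of_nat n)"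
    by (simp add: power2_eq_square)
  then show ?case
    unfolding wilson_basis_Suc[of h "Suc n"] pderiv_mult poly_add poly_mult zero Suc.IH
    by (simp add: pochhammer_Suc mult_ac del: poly_pCons of_nat_Suc)
qed

section \<open>The functional of the odd series\<close>

locale central_moments =
  fixes h :: "'a::field_char_0" and G :: "'a fps"
  assumes G: "G * (fps_exp (1/2) - fps_exp (-1/2)) = fps_X * (fps_exp h - fps_exp (- h))"
begin

text \<open>Each factor in the product form of \<open>G\<close> acts by duality: the divisor as a
  central difference, \<open>fps_X\<close> as a derivative, the exponentials as evaluations at
  \<open>h\<close> and \<open>- h\<close>.\<close>

lemma umbral_central_difference:
  "umbral G (p \<circ>\<^sub>p [:1/2, 1:] - p \<circ>\<^sub>p [:-1/2, 1:]) = poly (pderiv p) h - poly (pderiv p) (- h)"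
proof -
  have "umbral G (p \<circ>\<^sub>p [:1/2, 1:] - p \<circ>\<^sub>p [:-1/2, 1:]) =
      umbral (G * (fps_exp (1/2) - fps_exp (-1/2))) p"
    by (simp add: umbral_diff umbral_shift right_diff_distrib umbral_fps_diff mult.commute)
  also have "\<dots> = umbral (fps_exp h - fps_exp (- h)) (pderiv p)"
    by (simp only: G umbral_pderiv)
  finally show ?thesis by (simp add: umbral_fps_diff umbral_fps_exp)
qed

text \<open>Under \<open>t -> -t\<close> the divisor changes sign while the right-hand side of the
  defining equation is even. The divisor has linear coefficient 1, so it cancels.\<close>

lemma reflect_moments: "G oo (fps_const (-1) * fps_X) = - G"
proof -
  let ?r = "fps_const (-1) * fps_X :: 'a fps"
  let ?d = "fps_exp (1/2) - fps_exp (-1/2) :: 'a fps"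
  have exp: "fps_exp c oo ?r = fps_exp (- c)" for c :: 'a
    using fps_exp_compose_linear[of c "-1"] by simp
  have r: "fps_nth ?r 0 = 0" "fps_X oo ?r = - fps_X"
    by (simp_all flip: fps_const_neg)
  have "(G * ?d) oo ?r = (fps_X * (fps_exp h - fps_exp (- h))) oo ?r"
    by (simp only: G)
  then have "(G oo ?r) * (fps_exp (-1/2) - fps_exp (1/2)) = - fps_X * (fps_exp (- h) - fps_exp h)"
    unfolding fps_compose_mult_distrib[OF r(1)] fps_compose_sub_distrib exp r(2) by simp
  then have "(G oo ?r) * ?d = - (fps_X * (fps_exp h - fps_exp (- h)))"
    by (simp add: algebra_simps)
  then have "(G oo ?r) * ?d = - G * ?d"
    by (simp only: G[symmetric] mult_minus_left)
  moreover have "fps_nth ?d 1 \<noteq> 0" by simp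
  then have "?d \<noteq> 0" by (metis fps_zero_nth)
  ultimately show ?thesis by (metis mult_right_cancel)
qed

lemma umbral_even_eq_0:
  assumes "p \<circ>\<^sub>p [:0, -1:] = p"
  shows "umbral G p = 0"
  using umbral_reflect[of G p] by (simp add: assms reflect_moments umbral_fps_minus del: fps_const_neg)

lemma umbral_wilson_basis:
  "umbral G ([:0, 1:] * (wilson_basis (1/2 + h) i * wilson_basis (1/2 - h) j)) =
    2 * h * (fact i * pochhammer (1 + 2 * h) i) * (fact j * pochhammer (1 - 2 * h) j) / of_nat (i + j + 1)"
proof (induction j arbitrary: i)
  case 0
  \<comment> \<open>The derivative at \<open>x\<close> is proportional to \<open>x\<close>, so the
    endpoints \<open>h\<close> and \<open>- h\<close> contribute equally, whence
    \<open>- 4 * h\<close>.\<close>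
  have "- 2 * of_nat (Suc i) * umbral G ([:0, 1:] * wilson_basis (h + 1/2) i) =
      - 4 * h * (fact i * pochhammer (2 * h + 1) i)"
    using umbral_central_difference[of "wilson_basis h (Suc i)"]
    unfolding wilson_basis_shift_diff umbral_smult
    by (simp add: poly_pderiv_wilson_basis)
  then have "of_nat (Suc i) * umbral G ([:0, 1:] * wilson_basis (h + 1/2) i) =
      2 * h * (fact i * pochhammer (2 * h + 1) i)"
    by (simp only: mult_minus_left neg_equal_iff_equal mult.assoc) simp
  then have "umbral G ([:0, 1:] * wilson_basis (h + 1/2) i) =
      2 * h * (fact i * pochhammer (2 * h + 1) i) / of_nat (Suc i)"
    by (metis nonzero_mult_div_cancel_left of_nat_neq_0)
  then show ?case
    by (simp add: add.commute del: mult_pCons_left)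
next
  case (Suc j)
  let ?W = "\<lambda>i j. [:0, 1:] * (wilson_basis (1/2 + h) i * wilson_basis (1/2 - h) j)"
  \<comment> \<open>The difference \<open>(1/2 + h + i)^2 - (1/2 - h + j)^2\<close>, factored; its
    first factor cancels the denominator in the induction hypothesis.\<close>
  define c where "c = (1 + of_nat i + of_nat j) * (2 * h + of_nat i - of_nat j)"
  define K where "K = fact i * pochhammer (1 + 2 * h) i * (fact j * pochhammer (1 - 2 * h) j)"
  have "?W (Suc i) j - ?W i (Suc j) = smult c (?W i j)"
  proof (rule poly_ext)
    fix y
    have "(1/2 + h + of_nat i)^2 - (1/2 - h + of_nat j)^2 = c"
      by (simp add: c_def power2_eq_square field_simps)
    then show "poly (?W (Suc i) j - ?W i (Suc j)) y = poly (smult c (?W i j)) y"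
      by (simp add: wilson_basis_Suc) (simp add: algebra_simps)
  qed
  then have "umbral G (?W (Suc i) j) - umbral G (?W i (Suc j)) = c * umbral G (?W i j)"
    by (simp only: umbral_diff[symmetric] umbral_smult)
  moreover have "umbral G (?W (Suc i) j) =
      2 * h * K * ((of_nat (Suc i) * (1 + 2 * h + of_nat i)) / of_nat (i + j + 2))"
  proof -
    have "Suc i + j + 1 = i + j + 2" by simp
    then show ?thesis
      unfolding Suc.IH K_def pochhammer_Suc fact_Suc by (simp add: mult_ac del: of_nat_Suc of_nat_add)
  qed
  moreover have "c * umbral G (?W i j) = 2 * h * K * (c / of_nat (i + j + 1))"
    unfolding Suc.IH K_def by (simp add: mult_ac del: of_nat_Suc of_nat_add)
  ultimately have "umbral G (?W i (Suc j)) =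
      2 * h * K * ((of_nat (Suc i) * (1 + 2 * h + of_nat i)) / of_nat (i + j + 2) - c / of_nat (i + j + 1))"
    unfolding right_diff_distrib by (simp only: diff_eq_eq eq_diff_eq add.commute)
  also have "c / of_nat (i + j + 1) = 2 * h + of_nat i - of_nat j"
  proof -
    have "1 + of_nat i + of_nat j = (of_nat (i + j + 1) :: 'a)" by simp
    then show ?thesis unfolding c_def by (metis nonzero_mult_div_cancel_left of_nat_neq_0 Suc_eq_plus1)
  qed
  also have "(of_nat (Suc i) * (1 + 2 * h + of_nat i)) / of_nat (i + j + 2) - (2 * h + of_nat i - of_nat j) =
      of_nat (Suc j) * (1 - 2 * h + of_nat j) / of_nat (i + j + 2)"
  proof -
    have "(of_nat (i + j + 2) :: 'a) \<noteq> 0" by (simp only: of_nat_eq_0_iff)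
    then have "(of_nat (Suc i) * (1 + 2 * h + of_nat i)) / of_nat (i + j + 2) - (2 * h + of_nat i - of_nat j) =
      (of_nat (Suc i) * (1 + 2 * h + of_nat i) - (2 * h + of_nat i - of_nat j) * of_nat (i + j + 2)) / of_nat (i + j + 2)"
      by (simp only: diff_divide_distrib nonzero_mult_div_cancel_right not_False_eq_True)
    also have "of_nat (Suc i) * (1 + 2 * h + of_nat i) - (2 * h + of_nat i - of_nat j) * of_nat (i + j + 2) =
        of_nat (Suc j) * (1 - 2 * h + of_nat j)"
      by (simp add: algebra_simps)
    finally show ?thesis .
  qed
  finally show ?case
    by (simp add: K_def pochhammer_Suc mult_ac)
qed

end

section \<open>The determinants of even size\<close>

text \<open>The factor \<open>f l\<close> occurs once for each \<open>k\<close> from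
  \<open>l\<close> to \<open>m\<close>.\<close>

lemma prod_prod_triangle:
  fixes f :: "nat \<Rightarrow> 'a::comm_monoid_mult"
  shows "(\<Prod>k\<le>m. \<Prod>l = 1..k. f l) = (\<Prod>l = 1..m. f l ^ (m + 1 - l))"
proof (induction m)
  case (Suc m)
  have "(\<Prod>l = 1..m. f l ^ (Suc m + 1 - l)) = (\<Prod>l = 1..m. f l ^ (m + 1 - l) * f l)"
    by (intro prod.cong) (auto simp: Suc_diff_le mult_ac)
  with Suc show ?case
    by (simp add: prod.distrib mult_ac)
qed simp

lemma prod_power_triangle:
  "(\<Prod>l = 1..m. c ^ (2 * (m + 1 - l))) = (c :: 'a::comm_monoid_mult) ^ (m * (m + 1))"
proof (induction m)
  case (Suc m)
  have "(\<Prod>l = 1..Suc m. c ^ (2 * (Suc m + 1 - l))) = (\<Prod>l = 1..m. c ^ (2 * (Suc m + 1 - l))) * c ^ 2"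
    by simp
  also have "(\<Prod>l = 1..m. c ^ (2 * (Suc m + 1 - l))) = (\<Prod>l = 1..m. c ^ (2 * (m + 1 - l)) * c ^ 2)"
    by (intro prod.cong) (auto simp: Suc_diff_le power2_eq_square mult_ac)
  also have "\<dots> * c ^ 2 = c ^ (m * (m + 1) + 2 * m + 2)"
    by (simp only: prod.distrib Suc prod_constant card_atLeastAtMost power_add)
      (simp add: power_mult[of c 2 m])
  also have "m * (m + 1) + 2 * m + 2 = Suc m * (Suc m + 1)"
    by simp
  finally show ?case .
qed simp

text \<open>The left side joins the row factor, the column factor and the Hilbert pivot belonging to
  \<open>k\<close>; the quotient of consecutive values is the next factor of the target
  product.\<close>

lemma wilson_norm:
  fixes h :: "'a::field_char_0"
  shows "2 * h * (fact k * pochhammer (1 + 2 * h) k) * (fact k * pochhammer (1 - 2 * h) k) *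
      (of_nat (2 * k + 1) * (fact k ^ 2 / fact (2 * k + 1)) ^ 2) =
    2 * h * (\<Prod>l = 1..k. of_nat l ^ 4 * (of_nat l ^ 2 - (2 * h) ^ 2) /
      (4 * (2 * of_nat l + 1) * (2 * of_nat l - 1)))"
proof (induction k)
  case (Suc k)
  define u where "u = (of_nat (Suc k) :: 'a)"
  define v w where "v = (of_nat (2 * k + 1) :: 'a)" and "w = (of_nat (2 * k + 3) :: 'a)"
  have nz: "u \<noteq> 0" "v \<noteq> 0" "w \<noteq> 0"
    unfolding u_def v_def w_def by (simp_all only: of_nat_eq_0_iff)
  have vw: "2 * u - 1 = v" "2 * u + 1 = w"
    by (simp_all add: u_def v_def w_def)
  have facts: "fact (Suc k) = u * fact k" "fact (2 * Suc k + 1) = w * (2 * u) * fact (2 * k + 1)"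
    by (simp_all add: u_def w_def algebra_simps)
  have poch: "pochhammer (1 + 2 * h) (Suc k) = pochhammer (1 + 2 * h) k * (u + 2 * h)"
    "pochhammer (1 - 2 * h) (Suc k) = pochhammer (1 - 2 * h) k * (u - 2 * h)"
    by (simp_all add: pochhammer_Suc u_def algebra_simps)
  have w: "of_nat (2 * Suc k + 1) = w"
    by (simp add: w_def)
  define g where "g l = of_nat l ^ 4 * (of_nat l ^ 2 - (2 * h) ^ 2) / (4 * (2 * of_nat l + 1) * (2 * of_nat l - 1))"
    for l :: nat
  define X where "X = 2 * h * (fact k * pochhammer (1 + 2 * h) k) * (fact k * pochhammer (1 - 2 * h) k) *
      (of_nat (2 * k + 1) * (fact k ^ 2 / fact (2 * k + 1)) ^ 2)"
  have "2 * h * (fact (Suc k) * pochhammer (1 + 2 * h) (Suc k)) * (fact (Suc k) * pochhammer (1 - 2 * h) (Suc k)) *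
      (of_nat (2 * Suc k + 1) * (fact (Suc k) ^ 2 / fact (2 * Suc k + 1)) ^ 2) =
      X * (u ^ 4 * ((u + 2 * h) * (u - 2 * h)) / (4 * w * v))"
    unfolding facts poch w X_def v_def[symmetric]
    using nz by (simp add: power_mult_distrib power_divide) (simp add: divide_simps power2_eq_square power4_eq_xxxx)
  also have "(u + 2 * h) * (u - 2 * h) = u ^ 2 - (2 * h) ^ 2"
    by (simp add: power2_eq_square algebra_simps)
  also have "u ^ 4 * (u ^ 2 - (2 * h) ^ 2) / (4 * w * v) = g (Suc k)"
    by (simp only: g_def vw u_def[symmetric])
  also have "X * g (Suc k) = 2 * h * (\<Prod>l = 1..Suc k. g l)"
    unfolding X_def Suc.IH[folded g_def] by simp
  finally show ?case
    by (simp only: g_def)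
qed simp

context central_moments
begin

lemma hankel_det_odd:
  "hankel_det (2 * m + 1) (\<lambda>k. fact k * fps_nth G k) =
    (-1) ^ (m + 1) * (2 * h) ^ (2 * m + 2) *
    (\<Prod>l = 1..m. (of_nat l ^ 4 * (of_nat l ^ 2 - (2 * h) ^ 2) /
      (4 * (2 * of_nat l + 1) * (2 * of_nat l - 1))) ^ (2 * (m + 1 - l)))"
proof -
  \<comment> \<open>Even and odd polynomials interleaved so that the \<open>n\<close>-th has degree
    \<open>n\<close>. Its leading coefficient is a sign independent of \<open>a\<close>, so the two
    bases contribute 1 in \<open>det_gram\<close>.\<close>
  define P where "P a n = (if even n then wilson_basis a (n div 2) else [:0, 1:] * wilson_basis a (n div 2))"
    for a :: 'a and n
  have deg: "degree (P a n) \<le> n" for a n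
  proof (cases "even n")
    case True
    then show ?thesis using degree_wilson_basis[of a "n div 2"] by (simp add: P_def)
  next
    case False
    have "degree ([:0, 1:] * wilson_basis a (n div 2)) \<le> 1 + degree (wilson_basis a (n div 2))"
      using degree_mult_le[of "[:0, 1:]" "wilson_basis a (n div 2)"] by simp
    also have "\<dots> \<le> 1 + 2 * (n div 2)"
      using degree_wilson_basis[of a "n div 2"] by simp
    finally show ?thesis using False by (simp add: P_def)
  qed
  have lead: "coeff (P a n) n = (-1) ^ (n div 2)" for a n
    using coeff_wilson_basis[of a "n div 2"] by (cases "even n") (auto simp: P_def elim!: oddE)
  define E where "E i j = 2 * h * (fact i * pochhammer (1 + 2 * h) i) * (fact j * pochhammer (1 - 2 * h) j) *
    (1 / of_nat (i + j + 1))" for i j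
  have gram: "umbral G (P (1/2 + h) i * P (1/2 - h) j) =
      (if even (i + j) then 0 else E (i div 2) (j div 2))" for i j
  proof (cases "even (i + j)")
    case True
    \<comment> \<open>Indices of equal parity give an even product, which the odd functional
      kills.\<close>
    have "(P (1/2 + h) i * P (1/2 - h) j) \<circ>\<^sub>p [:0, -1:] = P (1/2 + h) i * P (1/2 - h) j"
    proof (cases "even i")
      case even: True
      with \<open>even (i + j)\<close> have "even j" by simp
      with even show ?thesis
        by (simp add: P_def pcompose_mult wilson_basis_reflect)
    next
      case odd: False
      with \<open>even (i + j)\<close> have "odd j" by simp
      with odd show ?thesis
        by (simp add: P_def pcompose_mult wilson_basis_reflect pcompose_pCons)
    qed
    with True show ?thesis by (simp add: umbral_even_eq_0)
  next
    case False
    then have "P (1/2 + h) i * P (1/2 - h) j =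
        [:0, 1:] * (wilson_basis (1/2 + h) (i div 2) * wilson_basis (1/2 - h) (j div 2))"
      by (cases "even i") (simp_all add: P_def)
    with False show ?thesis
      by (simp only: umbral_wilson_basis E_def) simp
  qed
  have "hankel_det (2 * m + 1) (\<lambda>k. fact k * fps_nth G k) =
      det (mat (2 * m + 1 + 1) (2 * m + 1 + 1) (\<lambda>(i, j). umbral G (P (1/2 + h) i * P (1/2 - h) j)))"
    using det_gram[of "2 * m + 1" "P (1/2 + h)" "P (1/2 - h)" G] 
    by (simp add: deg lead flip: power_add mult_2)
  also have "\<dots> = det (mat (2 * (m + 1)) (2 * (m + 1)) (\<lambda>(i, j). if even (i + j) then 0 else E (i div 2) (j div 2)))"
    unfolding gram by simp
  also have "\<dots> = (-1) ^ (m + 1) * det (mat (m + 1) (m + 1) (\<lambda>(i, j). E i j)) ^ 2"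
    by (rule det_checkerboard)
  also have "det (mat (m + 1) (m + 1) (\<lambda>(i, j). E i j)) =
      (\<Prod>k\<le>m. 2 * h * (\<Prod>l = 1..k. of_nat l ^ 4 * (of_nat l ^ 2 - (2 * h) ^ 2) /
      (4 * (2 * of_nat l + 1) * (2 * of_nat l - 1))))"
    unfolding E_def det_scale_rows_cols[of _ "\<lambda>i. 2 * h * (fact i * pochhammer (1 + 2 * h) i)" 
        "\<lambda>j. fact j * pochhammer (1 - 2 * h) j"] det_hilbert prod.distrib[symmetric] wilson_norm
    by (simp only: Suc_eq_plus1[symmetric] lessThan_Suc_atMost)
  also have "\<dots> = (2 * h) ^ (m + 1) * (\<Prod>l = 1..m. (of_nat l ^ 4 * (of_nat l ^ 2 - (2 * h) ^ 2) /
      (4 * (2 * of_nat l + 1) * (2 * of_nat l - 1))) ^ (m + 1 - l))"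
    by (simp only: prod.distrib[of "\<lambda>_. 2 * h"] prod_prod_triangle prod_constant card_atMost Suc_eq_plus1)
  finally show ?thesis
    by (simp only: power_mult_distrib[of "_ ^ _"] prod_power_distrib power_mult[symmetric] mult.commute[of _ 2]
        distrib_left mult.assoc mult_1_right)
qed

end

section \<open>From Bernoulli differences to the centred series\<close>

theorem theorem3p3:
  fixes q r s :: int and x :: "'a::field_char_0" and b :: "nat \<Rightarrow> 'a" and m :: nat
  assumes "q \<ge> 1" and "0 \<le> r" and "r < s"
    and b: "\<And>k. b k = bernpoly k ((x + of_int r) / of_int q) - bernpoly k ((x + of_int s) / of_int q)"
  shows "hankel_det (2 * m) b = 0 \<and>
    hankel_det (2 * m + 1) b =
      (-1) ^ (m + 1) * (of_int (s - r) / of_int q ^ (m + 1)) ^ (2 * m + 2) *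
      (\<Prod>l = 1..m. (of_nat l ^ 4 * (of_int (s - r) ^ 2 - (of_int q * of_nat l) ^ 2) /
                     (4 * (2 * of_nat l + 1) * (2 * of_nat l - 1))) ^ (2 * (m + 1 - l)))"
proof -
  define u v where "u = (x + of_int r) / of_int q" and "v = (x + of_int s) / of_int q"
  define F where "F = Abs_fps (\<lambda>k. b k / fact k)"
  \<comment> \<open>The exponent symmetrises both sides of \<open>F\<close>'s equation:
    \<open>e^t - 1\<close> carries the factor \<open>e^(t/2)\<close>, and
    \<open>e^(ut) - e^(vt)\<close> carries \<open>e^((u+v)t/2)\<close>.\<close>
  define G where "G = fps_exp (1/2 - (u + v) / 2) * F"
  define h where "h = (u - v) / 2"
  define Q where "Q = (of_int q :: 'a)"
  define D where "D = (of_int (s - r) :: 'a)"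
  have Q: "Q \<noteq> 0" using \<open>q \<ge> 1\<close> by (simp add: Q_def)
  have F: "F * (fps_exp 1 - 1) = fps_X * (fps_exp u - fps_exp v)"
  proof -
    have "F = Abs_fps (\<lambda>k. bernpoly k u / fact k) - Abs_fps (\<lambda>k. bernpoly k v / fact k)"
      by (simp add: F_def fps_eq_iff b u_def v_def diff_divide_distrib)
    then show ?thesis
      by (simp only: left_diff_distrib bernpoly_generating_function right_diff_distrib[symmetric])
  qed
  have "G * (fps_exp (1/2) - fps_exp (-1/2)) = fps_exp (- (u + v) / 2) * (F * (fps_exp 1 - 1))"
  proof -
    have "fps_exp (1/2) - fps_exp (-1/2) = fps_exp (-1/2) * (fps_exp 1 - 1 :: 'a fps)"
      by (simp add: right_diff_distrib flip: fps_exp_add_mult)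
    then have "G * (fps_exp (1/2) - fps_exp (-1/2)) =
        (fps_exp (1/2 - (u + v) / 2) * fps_exp (-1/2)) * (F * (fps_exp 1 - 1))"
      by (simp only: G_def mult_ac)
    moreover have "1/2 - w / 2 + (-1/2) = - w / 2" for w :: 'a
      by simp
    ultimately show ?thesis
      by (simp only: fps_exp_add_mult[symmetric])
  qed
  also have "\<dots> = fps_X * (fps_exp (- (u + v) / 2) * fps_exp u - fps_exp (- (u + v) / 2) * fps_exp v)"
    unfolding F by (simp only: right_diff_distrib mult.left_commute)
  also have "\<dots> = fps_X * (fps_exp h - fps_exp (- h))"
  proof -
    have "- (u + v) / 2 + u = h" "- (u + v) / 2 + v = - h"
      by (simp_all add: h_def field_simps)
    then show ?thesis by (simp only: fps_exp_add_mult[symmetric])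
  qed
  finally interpret central_moments h G
    by unfold_locales
  have hankel: "hankel_det n b = hankel_det n (\<lambda>k. fact k * fps_nth G k)" for n
    by (simp add: G_def hankel_det_binomial_transform) (simp add: F_def)
  have h: "2 * h = - (D / Q)"
    using Q by (simp add: h_def u_def v_def D_def flip: Q_def) (simp add: field_simps)
  have factor: "of_nat l ^ 4 * (of_nat l ^ 2 - (2 * h) ^ 2) / (4 * (2 * of_nat l + 1) * (2 * of_nat l - 1)) =
      - (1 / Q ^ 2) * (of_nat l ^ 4 * (D ^ 2 - (Q * of_nat l) ^ 2) / (4 * (2 * of_nat l + 1) * (2 * of_nat l - 1)))"
    for l
  proof -
    have "of_nat l ^ 2 - (2 * h) ^ 2 = - (1 / Q ^ 2) * (D ^ 2 - (Q * of_nat l) ^ 2)"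
      unfolding h power2_minus power_divide using Q by (simp add: field_simps)
    then show ?thesis by (simp only: times_divide_eq_right mult.left_commute)
  qed
  \<comment> \<open>The factors \<open>- (1 / Q^2)\<close> occur
    \<open>2 (1 + ... + m) = m (m + 1)\<close> times. This number is even, so the signs vanish, as
    does that of \<open>2 * h\<close>; the powers of \<open>Q\<close> add up to
    \<open>(m + 1)(2m + 2)\<close>.\<close>
  have scale: "(2 * h) ^ (2 * m + 2) * (- (1 / Q ^ 2)) ^ (m * (m + 1)) = (D / Q ^ (m + 1)) ^ (2 * m + 2)"
  proof -
    have "(2 * h) ^ (2 * m + 2) = D ^ (2 * m + 2) / Q ^ (2 * m + 2)"
      by (simp add: h power_divide)
    moreover have "(- (1 / Q ^ 2)) ^ (m * (m + 1)) = 1 / Q ^ (2 * (m * (m + 1)))"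
      by (simp add: power_one_over algebra_simps flip: power_mult)
    moreover have "Q ^ (2 * m + 2) * Q ^ (2 * (m * (m + 1))) = (Q ^ (m + 1)) ^ (2 * m + 2)"
      unfolding power_add[symmetric] power_mult[symmetric] by (rule arg_cong[of _ _ "(^) Q"]) (simp add: algebra_simps)
    ultimately show ?thesis
      by (simp add: power_divide[of D] del: power_Suc)
  qed
  have "hankel_det (2 * m + 1) b = (-1) ^ (m + 1) *
      ((2 * h) ^ (2 * m + 2) * (- (1 / Q ^ 2)) ^ (m * (m + 1))) *
      (\<Prod>l = 1..m. (of_nat l ^ 4 * (D ^ 2 - (Q * of_nat l) ^ 2) /
                     (4 * (2 * of_nat l + 1) * (2 * of_nat l - 1))) ^ (2 * (m + 1 - l)))"
    unfolding hankel hankel_det_odd factor power_mult_distrib[of "- (1 / Q ^ 2)"] prod.distrib prod_power_triangle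
    by (simp only: mult.assoc)
  then show ?thesis
    unfolding scale by (simp add: hankel hankel_det_even_eq_0[OF reflect_moments] D_def Q_def)
qed

end
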